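(* Let $(X,d)$ be a complete semimetric space with a triangle function $\Phi\colon\mathbb{R}^+\times\mathbb{R}^+\to\mathbb{R}^+$ that is continuous at $(0,0)$ and satisfies the following two conditions. (1) $\Phi(ku,kv)=k\,\Phi(u,v)$ for all $k,u,v\in\mathbb{R}^+$. (2) For every $0\le a<1$ there exists $C(a)>0$ such that for every positive integer $p$ $$\Phi(1,\Phi(a,\Phi(a^2,\ldots,\Phi(a^{p-1},a^{p}))))\le C(a).$$ Let $T\colon X\to X$ be a mapping for which there exist real numbers $\alpha,\delta$ with $0\le\alpha<1$ and $\delta\ge 0$ such that $$d(Tx,Ty)\le \alpha\, d(x,y)+\delta\, d(y,Tx)\quad\text{for all } x,y\in X.$$ Then $T$ has a fixed point. If $\delta=0$, then the fixed point is unique.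
   Context: $\mathbb{R}^+=[0,\infty)$. A semimetric space $(X,d)$ is a nonempty set $X$ with a function $d\colon X\times X\to\mathbb{R}^+$ such that for all $x,y\in X$: $d(x,y)=0$ if and only if $x=y$, and $d(x,y)=d(y,x)$. A function $\Phi\colon\mathbb{R}^+\times\mathbb{R}^+\to\mathbb{R}^+$ is a triangle function for $d$ if $\Phi$ is symmetric and non-decreasing in both of its arguments, $\Phi(0,0)=0$, and $d(x,y)\le\Phi(d(x,z),d(z,y))$ for all $x,y,z\in X$. A sequence $(x_n)$ in $X$ converges to $x\in X$ if $d(x_n,x)\to 0$; it is Cauchy if $d(x_n,x_m)\to 0$ as $n,m\to\infty$; $(X,d)$ is complete if every Cauchy sequence converges to some point of $X$. In condition (2) the expression is nested: for $p=1$ it is $\Phi(1,a)$, for $p=2$ it is $\Phi(1,\Phi(a,a^2))$, and so on. *)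

theory Defs
  imports "HOL-Analysis.Analysis"
begin

definition semimetric_space :: "'a set \<Rightarrow> ('a \<Rightarrow> 'a \<Rightarrow> real) \<Rightarrow> bool" where
  "semimetric_space X d \<longleftrightarrow>
     X \<noteq> {} \<and>
     (\<forall>x\<in>X. \<forall>y\<in>X. 0 \<le> d x y) \<and>
     (\<forall>x\<in>X. \<forall>y\<in>X. d x y = 0 \<longleftrightarrow> x = y) \<and>
     (\<forall>x\<in>X. \<forall>y\<in>X. d x y = d y x)"

definition semimetric_converges ::
    "'a set \<Rightarrow> ('a \<Rightarrow> 'a \<Rightarrow> real) \<Rightarrow> (nat \<Rightarrow> 'a) \<Rightarrow> 'a \<Rightarrow> bool" where
  "semimetric_converges X d s l \<longleftrightarrow>
     range s \<subseteq> X \<and> l \<in> X \<and> (\<lambda>n. d (s n) l) \<longlonglongrightarrow> 0"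

definition semimetric_Cauchy ::
    "'a set \<Rightarrow> ('a \<Rightarrow> 'a \<Rightarrow> real) \<Rightarrow> (nat \<Rightarrow> 'a) \<Rightarrow> bool" where
  "semimetric_Cauchy X d s \<longleftrightarrow>
     range s \<subseteq> X \<and>
     ((\<lambda>(n, m). d (s n) (s m)) \<longlongrightarrow> 0) (sequentially \<times>\<^sub>F sequentially)"

definition semimetric_complete :: "'a set \<Rightarrow> ('a \<Rightarrow> 'a \<Rightarrow> real) \<Rightarrow> bool" where
  "semimetric_complete X d \<longleftrightarrow>
     (\<forall>s. semimetric_Cauchy X d s \<longrightarrow> (\<exists>l. semimetric_converges X d s l))"

(* Functions on the closed quadrant are total functions on the reals of which only the
   values at nonnegative arguments matter. *)
definition triangle_function ::
    "'a set \<Rightarrow> ('a \<Rightarrow> 'a \<Rightarrow> real) \<Rightarrow> (real \<Rightarrow> real \<Rightarrow> real) \<Rightarrow> bool" where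
  "triangle_function X d \<Phi> \<longleftrightarrow>
     (\<forall>u\<ge>0. \<forall>v\<ge>0. 0 \<le> \<Phi> u v) \<and>
     (\<forall>u\<ge>0. \<forall>v\<ge>0. \<Phi> u v = \<Phi> v u) \<and>
     (\<forall>v\<ge>0. mono_on {0..} (\<lambda>u. \<Phi> u v)) \<and>
     (\<forall>u\<ge>0. mono_on {0..} (\<lambda>v. \<Phi> u v)) \<and>
     \<Phi> 0 0 = 0 \<and>
     (\<forall>x\<in>X. \<forall>y\<in>X. \<forall>z\<in>X. d x y \<le> \<Phi> (d x z) (d z y))"

(* power_nest \<Phi> a i p is
   \<Phi>(a^i, \<Phi>(a^(i+1), ..., \<Phi>(a^(i+p-1), a^(i+p)))), with p applications of \<Phi>. *)
primrec power_nest :: "(real \<Rightarrow> real \<Rightarrow> real) \<Rightarrow> real \<Rightarrow> nat \<Rightarrow> nat \<Rightarrow> real" where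
  "power_nest \<Phi> a i 0 = a ^ i"
| "power_nest \<Phi> a i (Suc p) = \<Phi> (a ^ i) (power_nest \<Phi> a (Suc i) p)"

lemma "power_nest \<Phi> a 0 1 = \<Phi> 1 a"
  by simp

lemma "power_nest \<Phi> a 0 2 = \<Phi> 1 (\<Phi> a (a ^ 2))"
  by (simp add: numeral_2_eq_2)

end

theory Submission
  imports Defs
begin

text \<open>
  The orbit \<open>s n = (T ^^ n) x0\<close> of any point converges to a fixed point. In the contractive
  condition for the pair \<open>s n\<close>, \<open>s (Suc n)\<close> the perturbation term is \<open>\<delta>\<close> times the distance from
  \<open>s (Suc n)\<close> to itself, so it vanishes, and consecutive distances decay like \<open>D * \<alpha> ^ n\<close> whatever
  \<open>\<delta>\<close> is. Chaining the triangle function along the orbit bounds the distance from \<open>s n\<close> to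
  \<open>s (n + p + 1)\<close> by the nested expression in \<open>\<alpha> ^ n, ..., \<alpha> ^ (n + p)\<close>, scaled by \<open>D\<close>
  (\<open>geometric_steps_dist_le_power_nest\<close>). By homogeneity the factor \<open>\<alpha> ^ n\<close> comes out
  (\<open>power_nest_shift\<close>), and what is left is the nested expression that condition (2) bounds
  uniformly in \<open>p\<close>. Hence these distances tend to \<open>0\<close> and the orbit is Cauchy
  (\<open>geometric_steps_semimetric_Cauchy\<close>).

  Let \<open>z\<close> be its limit. The contractive condition for \<open>s n\<close> and \<open>z\<close> shows that the orbit also
  converges to \<open>T z\<close>. A monotone homogeneous \<open>\<Phi>\<close> is dominated by a multiple of addition
  (\<open>homogeneous_mono_le_add\<close>), so limits are unique (\<open>semimetric_converges_unique\<close>) and \<open>T z = z\<close>.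
  For \<open>\<delta> = 0\<close> the distance of two fixed points is at most \<open>\<alpha>\<close> times itself, hence \<open>0\<close>.
\<close>

section \<open>Homogeneous triangle functions\<close>

lemma semimetric_spaceD:
  assumes "semimetric_space X d" "x \<in> X" "y \<in> X"
  shows "0 \<le> d x y" and "d x y = 0 \<longleftrightarrow> x = y" and "d x y = d y x"
  using assms unfolding semimetric_space_def by metis+

lemma triangle_function_nonneg:
  assumes "triangle_function X d \<Phi>" "0 \<le> u" "0 \<le> v"
  shows "0 \<le> \<Phi> u v"
  using assms unfolding triangle_function_def by blast

lemma triangle_function_mono:
  assumes "triangle_function X d \<Phi>" "0 \<le> u" "u \<le> u'" "0 \<le> v" "v \<le> v'"
  shows "\<Phi> u v \<le> \<Phi> u' v'"
proof -
  have "mono_on {0..} (\<lambda>u. \<Phi> u v)" "mono_on {0..} (\<lambda>v. \<Phi> u' v)"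
    using assms unfolding triangle_function_def by auto
  then have "\<Phi> u v \<le> \<Phi> u' v" "\<Phi> u' v \<le> \<Phi> u' v'"
    using assms by (auto elim!: mono_onD)
  then show ?thesis by simp
qed

lemma triangle_function_triangle:
  assumes "triangle_function X d \<Phi>" "x \<in> X" "y \<in> X" "z \<in> X"
  shows "d x y \<le> \<Phi> (d x z) (d z y)"
  using assms unfolding triangle_function_def by blast

text \<open>Both arguments are at most \<open>u + v\<close>, and \<open>\<Phi>\<close> is linear on the diagonal.\<close>

lemma homogeneous_mono_le_add:
  assumes "triangle_function X d \<Phi>"
    and hom: "\<forall>k\<ge>0. \<forall>u\<ge>0. \<forall>v\<ge>0. \<Phi> (k * u) (k * v) = k * \<Phi> u v"
    and "0 \<le> u" "0 \<le> v"
  shows "\<Phi> u v \<le> (u + v) * \<Phi> 1 1"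
proof -
  have "\<Phi> u v \<le> \<Phi> (u + v) (u + v)"
    using assms(3,4) by (intro triangle_function_mono[OF assms(1)]) auto
  also have "\<dots> = (u + v) * \<Phi> 1 1"
    using hom[rule_format, of "u + v" 1 1] assms by simp
  finally show ?thesis .
qed

lemma semimetric_converges_unique:
  assumes sm: "semimetric_space X d" and tri: "triangle_function X d \<Phi>"
    and hom: "\<forall>k\<ge>0. \<forall>u\<ge>0. \<forall>v\<ge>0. \<Phi> (k * u) (k * v) = k * \<Phi> u v"
    and y: "semimetric_converges X d s y" and z: "semimetric_converges X d s z"
  shows "y = z"
proof -
  have s: "s n \<in> X" for n
    using y unfolding semimetric_converges_def by auto
  have yz: "y \<in> X" "z \<in> X"
    using y z unfolding semimetric_converges_def by auto
  have lim: "(\<lambda>n. (d (s n) y + d (s n) z) * \<Phi> 1 1) \<longlonglongrightarrow> (0 + 0) * \<Phi> 1 1"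
    using y z unfolding semimetric_converges_def by (intro tendsto_intros) auto
  have "d y z \<le> (d (s n) y + d (s n) z) * \<Phi> 1 1" for n
  proof -
    have "d y z \<le> \<Phi> (d y (s n)) (d (s n) z)"
      using yz s by (rule triangle_function_triangle[OF tri])
    also have "\<dots> \<le> (d y (s n) + d (s n) z) * \<Phi> 1 1"
      using yz s by (intro homogeneous_mono_le_add[OF tri hom] semimetric_spaceD(1)[OF sm])
    also have "d y (s n) = d (s n) y"
      using sm yz(1) s by (rule semimetric_spaceD(3))
    finally show ?thesis .
  qed
  then have "d y z \<le> 0"
    using LIMSEQ_le_const[OF lim] by auto
  then show ?thesis
    using semimetric_spaceD[OF sm yz] by simp
qed

lemma power_nest_nonneg:
  assumes "triangle_function X d \<Phi>" "0 \<le> a"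
  shows "0 \<le> power_nest \<Phi> a i p"
  using assms(2) by (induction p arbitrary: i) (auto intro: triangle_function_nonneg[OF assms(1)])

lemma power_nest_shift:
  assumes tri: "triangle_function X d \<Phi>"
    and hom: "\<forall>k\<ge>0. \<forall>u\<ge>0. \<forall>v\<ge>0. \<Phi> (k * u) (k * v) = k * \<Phi> u v"
    and a: "0 \<le> a"
  shows "power_nest \<Phi> a i p = a ^ i * power_nest \<Phi> a 0 p"
proof -
  have step: "power_nest \<Phi> a (Suc i) p = a * power_nest \<Phi> a i p" for i
  proof (induction p arbitrary: i)
    case (Suc p)
    have "\<Phi> (a * a ^ i) (a * power_nest \<Phi> a (Suc i) p) = a * \<Phi> (a ^ i) (power_nest \<Phi> a (Suc i) p)"
      using hom a power_nest_nonneg[OF tri a] by simp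
    then show ?case
      using Suc[of "Suc i"] by simp
  qed simp
  show ?thesis
    by (induction i) (simp_all add: step del: power_nest.simps)
qed

section \<open>Sequences with geometrically decaying steps\<close>

text \<open>
  Splitting off the first step \<open>s n\<close>, \<open>s (n + 1)\<close> with the triangle function reproduces the
  right-nested recursion of \<open>power_nest\<close>; monotonicity inserts the bounds, and homogeneity moves
  \<open>D\<close> outside.
\<close>

lemma geometric_steps_dist_le_power_nest:
  assumes sm: "semimetric_space X d" and tri: "triangle_function X d \<Phi>"
    and hom: "\<forall>k\<ge>0. \<forall>u\<ge>0. \<forall>v\<ge>0. \<Phi> (k * u) (k * v) = k * \<Phi> u v"
    and a: "0 \<le> a" and D: "0 \<le> D"
    and s: "\<And>n. s n \<in> X" and steps: "\<And>n. d (s n) (s (Suc n)) \<le> D * a ^ n"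
  shows "d (s n) (s (Suc (n + p))) \<le> D * power_nest \<Phi> a n p"
proof (induction p arbitrary: n)
  case 0
  then show ?case using steps by simp
next
  case (Suc p)
  have "d (s n) (s (Suc (n + Suc p))) \<le> \<Phi> (d (s n) (s (Suc n))) (d (s (Suc n)) (s (Suc (n + Suc p))))"
    using s s s by (rule triangle_function_triangle[OF tri])
  also have "\<dots> \<le> \<Phi> (D * a ^ n) (D * power_nest \<Phi> a (Suc n) p)"
    using s steps Suc[of "Suc n"]
    by (intro triangle_function_mono[OF tri] semimetric_spaceD(1)[OF sm]) auto
  also have "\<dots> = D * power_nest \<Phi> a n (Suc p)"
    using hom D a power_nest_nonneg[OF tri a] by simp
  finally show ?case .
qed

lemma geometric_steps_semimetric_Cauchy:
  assumes sm: "semimetric_space X d" and tri: "triangle_function X d \<Phi>"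
    and hom: "\<forall>k\<ge>0. \<forall>u\<ge>0. \<forall>v\<ge>0. \<Phi> (k * u) (k * v) = k * \<Phi> u v"
    and a: "0 \<le> a" "a < 1" and D: "0 \<le> D"
    and s: "\<And>n. s n \<in> X" and steps: "\<And>n. d (s n) (s (Suc n)) \<le> D * a ^ n"
    and C: "\<forall>p\<ge>1. power_nest \<Phi> a 0 p \<le> C"
  shows "semimetric_Cauchy X d s"
proof -
  \<comment> \<open>The bound \<open>C\<close> concerns \<open>p \<ge> 1\<close>; the maximum also covers \<open>p = 0\<close>, where the nested
      expression is \<open>1\<close>.\<close>
  define K where "K = D * max 1 C"
  have K: "0 \<le> K"
    using D by (simp add: K_def)
  have nest: "power_nest \<Phi> a 0 p \<le> max 1 C" for p
  proof (cases p)
    case (Suc q)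
    then have "power_nest \<Phi> a 0 p \<le> C" by (intro C[rule_format]) simp
    then show ?thesis by simp
  qed simp
  have forward: "d (s n) (s m) \<le> K * a ^ n" if less: "n < m" for n m
  proof -
    obtain p where m: "m = Suc (n + p)"
      using less_imp_Suc_add[OF less] by blast
    have "d (s n) (s m) \<le> D * (a ^ n * power_nest \<Phi> a 0 p)"
      unfolding m power_nest_shift[OF tri hom a(1), of n p, symmetric]
      using sm tri hom a(1) D s steps by (rule geometric_steps_dist_le_power_nest)
    also have "\<dots> \<le> D * (a ^ n * max 1 C)"
      using D a nest by (intro mult_left_mono) auto
    finally show ?thesis by (simp add: K_def mult_ac)
  qed
  have bound: "d (s n) (s m) \<le> K * a ^ n + K * a ^ m" for n m
  proof -
    have nonneg: "0 \<le> K * a ^ n" "0 \<le> K * a ^ m"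
      using K a by auto
    consider "n < m" | "n = m" | "m < n" by linarith
    then show ?thesis
    proof cases
      case 1
      then show ?thesis using forward[of n m] nonneg by simp
    next
      case 2
      then show ?thesis using semimetric_spaceD(2)[OF sm s s, of n m] nonneg by simp
    next
      case 3
      have "d (s n) (s m) = d (s m) (s n)"
        using sm s s by (rule semimetric_spaceD(3))
      then show ?thesis using forward[OF 3] nonneg by simp
    qed
  qed
  have decay: "(\<lambda>n. K * a ^ n) \<longlonglongrightarrow> 0"
    using tendsto_mult_left[OF LIMSEQ_realpow_zero[OF a], of K] by simp
  have "((\<lambda>q. K * a ^ fst q) \<longlongrightarrow> 0) (sequentially \<times>\<^sub>F sequentially)"
      "((\<lambda>q. K * a ^ snd q) \<longlongrightarrow> 0) (sequentially \<times>\<^sub>F sequentially)"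
    by (rule filterlim_compose[OF decay filterlim_fst], rule filterlim_compose[OF decay filterlim_snd])
  from tendsto_add[OF this]
  have lim: "((\<lambda>q. K * a ^ fst q + K * a ^ snd q) \<longlongrightarrow> 0) (sequentially \<times>\<^sub>F sequentially)"
    by simp
  have "((\<lambda>(n, m). d (s n) (s m)) \<longlongrightarrow> 0) (sequentially \<times>\<^sub>F sequentially)"
    by (rule tendsto_sandwich[OF _ _ tendsto_const lim])
      (auto intro!: always_eventually semimetric_spaceD(1)[OF sm] s bound)
  then show ?thesis
    using s unfolding semimetric_Cauchy_def by auto
qed

section \<open>The fixed point theorem\<close>

theorem theorem2p3:
  fixes X :: "'a set" and d :: "'a \<Rightarrow> 'a \<Rightarrow> real"
    and \<Phi> :: "real \<Rightarrow> real \<Rightarrow> real" and T :: "'a \<Rightarrow> 'a" and \<alpha> \<delta> :: real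
  assumes "semimetric_space X d"
    and "semimetric_complete X d"
    and "triangle_function X d \<Phi>"
    and "continuous (at (0, 0) within {0..} \<times> {0..}) (\<lambda>(u, v). \<Phi> u v)"
    and "\<forall>k\<ge>0. \<forall>u\<ge>0. \<forall>v\<ge>0. \<Phi> (k * u) (k * v) = k * \<Phi> u v"
    and "\<forall>a. 0 \<le> a \<and> a < 1 \<longrightarrow> (\<exists>C>0. \<forall>p\<ge>1. power_nest \<Phi> a 0 p \<le> C)"
    and "T \<in> X \<rightarrow> X"
    and "0 \<le> \<alpha>" and "\<alpha> < 1" and "0 \<le> \<delta>"
    and "\<forall>x\<in>X. \<forall>y\<in>X. d (T x) (T y) \<le> \<alpha> * d x y + \<delta> * d y (T x)"
  shows "(\<exists>x\<in>X. T x = x) \<and> (\<delta> = 0 \<longrightarrow> (\<exists>!x. x \<in> X \<and> T x = x))"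
proof -
  note sm = assms(1) and tri = assms(3) and hom = assms(5)
  have contr: "d (T x) (T y) \<le> \<alpha> * d x y + \<delta> * d y (T x)" if "x \<in> X" "y \<in> X" for x y
    using assms(11) that by blast
  note nonneg = semimetric_spaceD(1)[OF sm] and zero = semimetric_spaceD(2)[OF sm]
    and sym = semimetric_spaceD(3)[OF sm]
  have TX: "T x \<in> X" if "x \<in> X" for x
    using assms(7) that by auto
  obtain x0 where x0: "x0 \<in> X"
    using sm unfolding semimetric_space_def by auto
  define s where "s n = (T ^^ n) x0" for n
  have s_Suc: "s (Suc n) = T (s n)" for n
    by (simp add: s_def)
  have s: "s n \<in> X" for n
    by (induction n) (auto simp: s_def x0 TX)
  have steps: "d (s n) (s (Suc n)) \<le> d (s 0) (s 1) * \<alpha> ^ n" for n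
  proof (induction n)
    case (Suc n)
    have "d (s (Suc n)) (s (Suc (Suc n)))
        \<le> \<alpha> * d (s n) (s (Suc n)) + \<delta> * d (s (Suc n)) (s (Suc n))"
      using contr[OF s s, of n "Suc n"] by (simp add: s_Suc)
    also have "\<dots> = \<alpha> * d (s n) (s (Suc n))"
      using zero s by simp
    also have "\<dots> \<le> \<alpha> * (d (s 0) (s 1) * \<alpha> ^ n)"
      using Suc assms(8) by (rule mult_left_mono)
    finally show ?case by (simp add: mult_ac)
  qed simp
  obtain C where C: "\<forall>p\<ge>1. power_nest \<Phi> \<alpha> 0 p \<le> C"
    using assms(6,8,9) by blast
  have "semimetric_Cauchy X d s"
    using sm tri hom assms(8,9) nonneg[OF s s] s steps C
    by (rule geometric_steps_semimetric_Cauchy)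
  then obtain z where z: "semimetric_converges X d s z"
    using assms(2) unfolding semimetric_complete_def by blast
  then have zX: "z \<in> X" and lim: "(\<lambda>n. d (s n) z) \<longlonglongrightarrow> 0"
    unfolding semimetric_converges_def by auto
  have lim': "(\<lambda>n. d (s (Suc n)) z) \<longlonglongrightarrow> 0"
    using lim by (rule LIMSEQ_Suc)
  have upper: "d (s (Suc n)) (T z) \<le> \<alpha> * d (s n) z + \<delta> * d (s (Suc n)) z" for n
    using contr[OF s zX, of n] sym[OF zX s, of "Suc n"] by (simp add: s_Suc)
  have upper_lim: "(\<lambda>n. \<alpha> * d (s n) z + \<delta> * d (s (Suc n)) z) \<longlonglongrightarrow> 0"
    using tendsto_add[OF tendsto_mult_left[OF lim] tendsto_mult_left[OF lim']] by simp
  have "(\<lambda>n. d (s (Suc n)) (T z)) \<longlonglongrightarrow> 0"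
    by (rule tendsto_sandwich[OF _ _ tendsto_const upper_lim])
      (simp_all add: upper nonneg[OF s TX[OF zX]])
  then have "semimetric_converges X d (\<lambda>n. s (Suc n)) (T z)"
    using s TX zX unfolding semimetric_converges_def by auto
  moreover have "semimetric_converges X d (\<lambda>n. s (Suc n)) z"
    using s zX lim' unfolding semimetric_converges_def by auto
  ultimately have fixed: "T z = z"
    by (rule semimetric_converges_unique[OF sm tri hom])
  have "x = y" if "\<delta> = 0" "x \<in> X" "T x = x" "y \<in> X" "T y = y" for x y
  proof -
    have "d x y \<le> \<alpha> * d x y"
      using contr[of x y] that by simp
    then have "(1 - \<alpha>) * d x y \<le> 0"
      by (simp add: algebra_simps)
    then have "d x y \<le> 0"
      using assms(9) by (simp add: mult_le_0_iff)
    then show ?thesis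
      using nonneg[of x y] zero[of x y] that by simp
  qed
  then show ?thesis
    using fixed zX by blast
qed

end
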